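(* Let $a,d,K,k$ be positive integers with $a\ge 2$, $\gcd(a,d)=1$ and $K\le (k-1)/2$, and put $r=a+K-\lfloor (a+K)/k\rfloor k$. Then $$ g(a,a+(K+1)d,a+(K+2)d,\dots,a+k d)=\begin{cases}\dfrac{a(a+K-r)}{k}+(a+K)d&\text{if } r>0,\\[1ex] \dfrac{a(a+K-k)}{k}+(a+K)d&\text{if } r=0,\end{cases} $$ and in both cases this equals $\left(\lceil (a+K)/k\rceil-1\right)a+(a+K)d$.
   Context: For positive integers $a_1,\dots,a_m$ with $\gcd(a_1,\dots,a_m)=1$, the Frobenius number $g(a_1,\dots,a_m)$ is the largest positive integer that cannot be written as $x_1a_1+\cdots+x_ma_m$ with nonnegative integers $x_i$. $\lfloor x\rfloor$ and $\lceil x\rceil$ denote floor and ceiling.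
   Formalization: The formal theorem adds the hypothesis that a does not divide K; if a divides K the stated value is a multiple of a, hence representable, so the formula fails (e.g. a=K=2, d=1, k=5: g(2,5,6,7)=3, but the formula gives 4). *)

theory Defs
  imports Complex_Main
begin

definition representable :: "nat list \<Rightarrow> nat \<Rightarrow> bool" where
  "representable as n \<longleftrightarrow> (\<exists>x :: nat \<Rightarrow> nat. n = (\<Sum>i<length as. x i * as ! i))"

text \<open>
  The value is meaningful when the entries of \<open>as\<close> are positive with greatest common
  divisor 1 (so that only finitely many numbers are not representable) and 1 is not among
  them (so that some positive number is not representable); otherwise it is unspecified.
\<close>
definition frobenius_number :: "nat list \<Rightarrow> nat" where
  "frobenius_number as = (GREATEST n. 0 < n \<and> \<not> representable as n)"

text \<open>The sequence $a,\ a+(K+1)d,\ a+(K+2)d,\ \dots,\ a+kd$.\<close>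
definition gap_progression :: "nat \<Rightarrow> nat \<Rightarrow> nat \<Rightarrow> nat \<Rightarrow> nat list" where
  "gap_progression a d K k = a # map (\<lambda>i. a + i * d) [K + 1..<k + 1]"

lemma frobenius_number_eqI:
  assumes "0 < n" "\<not> representable as n" "\<And>m. n < m \<Longrightarrow> representable as m"
  shows "frobenius_number as = n"
  unfolding frobenius_number_def
  by (rule Greatest_equality) (use assms in \<open>auto simp: not_less[symmetric]\<close>)

text \<open>
  If $a$ divides $K$, then the value $(\lceil (a+K)/k\rceil-1)a+(a+K)d$ is a multiple of $a$,
  hence representable, and cannot be the Frobenius number. The following instance, with
  $a=K=2$, $d=1$, $k=5$, satisfies $a \ge 2$, $\gcd(a,d)=1$ and $K\le(k-1)/2$; there that value
  is 4, while the Frobenius number is 3.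
\<close>
lemma frobenius_number_when_a_dvd_K: "frobenius_number (gap_progression 2 1 2 5) = 3"
proof -
  have gp: "gap_progression 2 1 2 5 = [2, 5, 6, 7]"
    by (simp add: gap_progression_def upt_rec)
  have rep: "representable [2, 5, 6, 7] m \<longleftrightarrow> (\<exists>x :: nat \<Rightarrow> nat.
      m = x 0 * 2 + x 1 * 5 + x 2 * 6 + x 3 * 7)" for m
    by (simp add: representable_def numeral_eq_Suc)
  have "representable [2, 5, 6, 7] m" if "3 < m" for m
  proof (cases "even m")
    case True
    then show ?thesis
      unfolding rep by (intro exI[of _ "\<lambda>i. if i = 0 then m div 2 else 0"]) simp
  next
    case False
    with that have "m = (m - 5) div 2 * 2 + 1 * 5" by presburger
    then show ?thesis
      unfolding rep
      by (intro exI[of _ "\<lambda>i. if i = 0 then (m - 5) div 2 else if i = 1 then 1 else 0"]) simp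
  qed
  moreover have "\<not> representable [2, 5, 6, 7] 3"
  proof
    assume "representable [2, 5, 6, 7] 3"
    then obtain x :: "nat \<Rightarrow> nat" where "3 = x 0 * 2 + x 1 * 5 + x 2 * 6 + x 3 * 7"
      unfolding rep by blast
    then show False by arith
  qed
  ultimately show ?thesis
    unfolding gp by (intro frobenius_number_eqI) auto
qed

end

theory Submission
  imports Defs "HOL-Number_Theory.Cong"
begin

text \<open>
  A sum of \<open>s\<close> generators has the form \<open>s a + t d\<close>, where \<open>t\<close> is a sum of at most \<open>s\<close> steps from
  \<open>[K+1, k]\<close>. Since \<open>2K + 1 \<le> k\<close>, the intervals \<open>[m(K+1), mk]\<close> leave no gaps for \<open>m \<ge> 1\<close>, so the
  only conditions on \<open>t\<close> are \<open>t = 0\<close> or \<open>K < t \<le> s k\<close>. In a residue class modulo \<open>a\<close> it is best to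
  take \<open>t\<close> least possible; the worst class is that of \<open>t = a + K\<close>, which needs \<open>\<lceil>(a+K)/k\<rceil>\<close>
  generators.
\<close>

lemma representable_add:
  assumes "representable as m" "representable as n"
  shows "representable as (m + n)"
proof -
  obtain x y where "m = (\<Sum>i<length as. x i * as ! i)" "n = (\<Sum>i<length as. y i * as ! i)"
    using assms unfolding representable_def by blast
  then have "m + n = (\<Sum>i<length as. (x i + y i) * as ! i)"
    by (simp add: sum.distrib add_mult_distrib)
  then show ?thesis
    unfolding representable_def by (intro exI)
qed

lemma representable_mult:
  assumes "b \<in> set as"
  shows "representable as (c * b)"
proof -
  obtain j where "j < length as" "b = as ! j"
    using assms by (auto simp: in_set_conv_nth)
  then have "c * b = (\<Sum>i<length as. (if i = j then c else 0) * as ! i)"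
    by (simp add: if_distrib[of "\<lambda>y. y * _"] cong: if_cong)
  then show ?thesis
    unfolding representable_def by (intro exI)
qed

text \<open>Replaces coefficient vectors by growth from \<open>0\<close> one generator at a time, so
  that an invariant only has to survive a single addition.\<close>

lemma representable_induct [consumes 1, case_names zero add]:
  assumes "representable as n"
    and zero: "P 0"
    and add: "\<And>b m. b \<in> set as \<Longrightarrow> P m \<Longrightarrow> P (b + m)"
  shows "P n"
proof -
  have mult: "P (c * b + m)" if "b \<in> set as" "P m" for b c m
    using that by (induction c) (auto simp: add.assoc intro: add)
  obtain x where n: "n = (\<Sum>i<length as. x i * as ! i)"
    using assms(1) unfolding representable_def by blast
  have "P (\<Sum>i<l. x i * as ! i)" if "l \<le> length as" for l
    using that
  proof (induction l)
    case 0
    then show ?case by (simp add: zero)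
  next
    case (Suc l)
    then show ?case
      using mult[of "as ! l" "\<Sum>i<l. x i * as ! i" "x l"] by (simp add: add.commute)
  qed
  then show ?thesis by (simp add: n)
qed

lemma set_gap_progression:
  "set (gap_progression a d K k) = insert a ((\<lambda>i. a + i * d) ` {K + 1..k})"
  by (auto simp: gap_progression_def)

text \<open>Here \<open>s\<close> counts the generators used and \<open>t\<close> adds up their
  steps, where \<open>a\<close> itself has step \<open>0\<close>. A single nonzero step already
  exceeds \<open>K\<close>, and no step exceeds \<open>k\<close>.\<close>

lemma representable_gap_progressionD:
  assumes "representable (gap_progression a d K k) n"
  obtains s t where "n = s * a + t * d" "t = 0 \<or> K < t" "t \<le> s * k"
proof -
  from assms have "\<exists>s t. n = s * a + t * d \<and> (t = 0 \<or> K < t) \<and> t \<le> s * k"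
  proof (induction rule: representable_induct)
    case zero
    show ?case by (intro exI[of _ 0]) simp
  next
    case (add b m)
    then obtain s t where st: "m = s * a + t * d" "t = 0 \<or> K < t" "t \<le> s * k"
      by blast
    from add(1) consider "b = a" | i where "b = a + i * d" "i \<in> {K + 1..k}"
      unfolding set_gap_progression by blast
    then show ?case
    proof cases
      case 1
      with st show ?thesis by (intro exI[of _ "Suc s"] exI[of _ t]) simp
    next
      case 2
      with st show ?thesis
        by (intro exI[of _ "Suc s"] exI[of _ "i + t"]) (auto simp: add_mult_distrib)
    qed
  qed
  then show thesis using that by blast
qed

text \<open>Induction on the number of generators: one of step \<open>i\<close> is split off so that
  \<open>t - i\<close> is either \<open>0\<close> or again lies above \<open>K\<close> and within
  reach of the remaining \<open>s\<close> generators.\<close>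

lemma representable_gap_progressionI:
  assumes "2 * K < k" "K < t" "t \<le> s * k"
  shows "representable (gap_progression a d K k) (s * a + t * d)"
  using assms(2,3)
proof (induction s arbitrary: t)
  case 0
  then show ?case by simp
next
  case (Suc s)
  let ?R = "representable (gap_progression a d K k)"
  have step: "?R (a + i * d)" if "K < i" "i \<le> k" for i
  proof -
    have "a + i * d \<in> set (gap_progression a d K k)"
      unfolding set_gap_progression using that by (intro insertI2 imageI) simp
    from representable_mult[OF this, of 1] show ?thesis by simp
  qed
  have split: "?R (Suc s * a + t * d)" if "K < i" "i \<le> k" "i \<le> t" "?R (s * a + (t - i) * d)" for i
  proof -
    have "Suc s * a + t * d = (a + i * d) + (s * a + (t - i) * d)"
      using \<open>i \<le> t\<close> by (simp flip: add_mult_distrib)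
    then show ?thesis
      using representable_add[OF step[OF that(1,2)] that(4)] by (simp only:)
  qed
  \<comment> \<open>The greedy choice \<open>i = k\<close> works only if \<open>t - k\<close> stays
    above \<open>K\<close>. In the middle range it would leave a remainder in the gap from
    \<open>1\<close> to \<open>K\<close>, so the smallest step \<open>K + 1\<close> is removed
    instead.\<close>
  consider "t \<le> k" | "k < t" "t \<le> k + K" | "k + K < t"
    by linarith
  then show ?case
  proof cases
    case 1
    moreover have "?R (s * a)"
      by (rule representable_mult) (simp add: set_gap_progression)
    ultimately show ?thesis
      using Suc.prems by (intro split[of t]) auto
  next
    case 2
    then have "0 < s"
      using Suc.prems by (cases s) auto
    then have "k \<le> s * k"
      by simp
    \<comment> \<open>The remainder \<open>t - (K + 1)\<close> is at least \<open>k - K\<close>,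
      which exceeds \<open>K\<close> because \<open>2 * K < k\<close>, and it is below
      \<open>k \<le> s * k\<close>.\<close>
    with 2 assms(1) show ?thesis
      by (intro split[of "K + 1"] Suc.IH) linarith+
  next
    case 3
    with Suc.prems assms(1) show ?thesis
      by (intro split[of k] Suc.IH) auto
  qed
qed

text \<open>Cancelling \<open>d\<close> modulo \<open>a\<close> puts \<open>t\<close> in the class
  of \<open>K\<close>. Since \<open>t\<close> is nonzero it exceeds \<open>K\<close>, hence is at
  least \<open>a + K\<close>; this leaves at most \<open>q\<close> generators, whose steps sum to at
  most \<open>q * k < a + K\<close>.\<close>

lemma not_representable_gap_progression:
  assumes "coprime a d" "\<not> a dvd K" "q * k < a + K"
  shows "\<not> representable (gap_progression a d K k) (q * a + (a + K) * d)"
proof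
  assume "representable (gap_progression a d K k) (q * a + (a + K) * d)"
  then obtain s t where st: "q * a + (a + K) * d = s * a + t * d" "t = 0 \<or> K < t" "t \<le> s * k"
    by (rule representable_gap_progressionD)
  have "[K * d = q * a + (a + K) * d] (mod a)"
    by (simp add: cong_def add_mult_distrib mod_add_eq mod_add_left_eq [symmetric])
  also have "[q * a + (a + K) * d = t * d] (mod a)"
    by (simp add: st(1) cong_def)
  finally have cong: "[K = t] (mod a)"
    using assms(1) by (simp add: cong_mult_rcancel_nat coprime_commute)
  with assms(2) have "t \<noteq> 0"
    by (metis cong_0_iff)
  with st(2) have "K < t" by simp
  with cong have "a dvd t - K"
    by (metis cong_sym cong_altdef_nat less_imp_le)
  with \<open>K < t\<close> have t: "a + K \<le> t"
    using dvd_imp_le[of a "t - K"] by simp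
  then have "(a + K) * d \<le> t * d" by simp
  with st(1) have "s * a \<le> q * a" by linarith
  \<comment> \<open>Congruence modulo \<open>0\<close> is equality, which would give
    \<open>K = t\<close>.\<close>
  moreover have "a \<noteq> 0"
    using \<open>K < t\<close> cong by (intro notI) (simp add: cong_def)
  ultimately have "s \<le> q" by simp
  then have "s * k \<le> q * k" by simp
  with st(3) t assms(3) show False by linarith
qed

text \<open>The \<open>a\<close> consecutive values from \<open>K + 1\<close> to
  \<open>K + a\<close> meet every residue class, so one of them serves as \<open>t\<close> with
  \<open>t * d\<close> congruent to \<open>m\<close>. The rest \<open>m - t * d\<close> is a
  multiple of \<open>a\<close> above \<open>q * a\<close>, so there are at least
  \<open>q + 1\<close> generators, enough to reach \<open>t \<le> a + K\<close>.\<close>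

lemma representable_above_gap_progression:
  assumes "a > 0" "coprime a d" "2 * K < k" "a + K \<le> Suc q * k" "q * a + (a + K) * d < m"
  shows "representable (gap_progression a d K k) m"
proof -
  \<comment> \<open>Ensures that the natural-number subtraction \<open>m - (K + 1) * d\<close> does
    not truncate.\<close>
  have m: "(K + 1) * d \<le> m"
  proof -
    have "(K + 1) * d \<le> (a + K) * d" using assms(1) by (intro mult_le_mono1) simp
    with assms(5) show ?thesis by linarith
  qed
  obtain x where "[d * x = Suc 0] (mod a)"
    using cong_solve_coprime_nat[of d a] assms(2) by (auto simp: coprime_commute)
  then have "[d * x * (m - (K + 1) * d) = 1 * (m - (K + 1) * d)] (mod a)"
    by (intro cong_mult) simp_all
  then have cong: "[d * (x * (m - (K + 1) * d) mod a) = m - (K + 1) * d] (mod a)"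
    by (simp only: cong_def mod_mult_right_eq mult.assoc mult_1)
  \<comment> \<open>With \<open>x\<close> inverse to \<open>d\<close> modulo \<open>a\<close>, the
    reduced offset solves the congruence, and the shift by \<open>K + 1\<close> places
    \<open>t\<close> beyond the gap.\<close>
  define t where "t = K + 1 + x * (m - (K + 1) * d) mod a"
  have "K < t" "t \<le> a + K"
    using mod_less_divisor[OF assms(1), of "x * (m - (K + 1) * d)"] unfolding t_def by linarith+
  have "[t * d = m] (mod a)"
    using cong_add[OF cong_refl cong, of "(K + 1) * d"] m by (simp only: t_def add_mult_distrib le_add_diff_inverse mult.commute[of d])
  moreover have "t * d \<le> (a + K) * d"
    using \<open>t \<le> a + K\<close> by simp
  moreover from this have "t * d \<le> m"
    using assms(5) by linarith
  ultimately obtain s where s: "m - t * d = a * s"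
    by (metis cong_sym cong_altdef_nat dvdE)
  then have "q * a < s * a"
    using assms(5) \<open>t * d \<le> (a + K) * d\<close> by (simp only: mult.commute[of s])
  then have "Suc q \<le> s" by simp
  then have "Suc q * k \<le> s * k"
    by (rule mult_le_mono1)
  with \<open>t \<le> a + K\<close> assms(4) have "t \<le> s * k" by linarith
  moreover have "m = s * a + t * d"
    using s \<open>t * d \<le> m\<close> by (simp add: mult.commute)
  ultimately show ?thesis
    using representable_gap_progressionI assms(3) \<open>K < t\<close> by blast
qed

theorem theorem2:
  fixes a d K k :: nat and r :: int
  assumes "a \<ge> 2" and "d > 0" and "K > 0" and "k > 0"
    and "gcd a d = 1"
    and "real K \<le> (real k - 1) / 2"
    and "\<not> a dvd K"
    and "r = int (a + K) - \<lfloor>real (a + K) / real k\<rfloor> * int k"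
  shows "real (frobenius_number (gap_progression a d K k)) =
           (if r > 0
            then real a * (real a + real K - real_of_int r) / real k + (real a + real K) * real d
            else real a * (real a + real K - real k) / real k + (real a + real K) * real d)
         \<and> (r > 0 \<or> r = 0)
         \<and> int (frobenius_number (gap_progression a d K k)) =
           (\<lceil>real (a + K) / real k\<rceil> - 1) * int a + int (a + K) * int d"
proof -
  \<comment> \<open>Subtracting \<open>1\<close> before dividing makes \<open>q * k\<close> the
    largest multiple of \<open>k\<close> strictly below \<open>a + K\<close>, so
    \<open>q + 1\<close> is the ceiling of \<open>(a + K) / k\<close>.\<close>
  define q where "q = (a + K - 1) div k"
  define N where "N = q * a + (a + K) * d"
  have "real (2 * K + 1) \<le> real k"
    using assms(6) by simp
  then have k: "2 * K < k"
    by (simp only: of_nat_le_iff)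
  have "q * k \<le> a + K - 1"
    by (simp add: q_def)
  with assms(1) have q_less: "q * k < a + K" by linarith
  have "a + K - 1 < Suc q * k"
    unfolding q_def using dividend_less_div_times[OF assms(4), of "a + K - 1"] by simp
  then have q_ge: "a + K \<le> Suc q * k" by linarith
  have frob: "frobenius_number (gap_progression a d K k) = N"
    unfolding N_def
    using assms k q_less q_ge
    by (intro frobenius_number_eqI not_representable_gap_progression
        representable_above_gap_progression) (auto simp: coprime_iff_gcd_eq_1)
  have ceil: "\<lceil>real (a + K) / real k\<rceil> = int q + 1"
  proof (rule ceiling_unique)
    show "real_of_int (int q + 1) - 1 < real (a + K) / real k"
      using q_less assms(4) by (simp add: pos_less_divide_eq flip: of_nat_mult of_nat_add)
    have "real (a + K) \<le> real (Suc q * k)"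
      using q_ge by (simp only: of_nat_le_iff)
    then show "real (a + K) / real k \<le> real_of_int (int q + 1)"
      using assms(4) by (simp add: pos_divide_le_eq algebra_simps)
  qed
  have r: "r = int ((a + K) mod k)"
  proof -
    have "int (a + K) = int ((a + K) div k * k + (a + K) mod k)"
      by (simp only: div_mult_mod_eq)
    then show ?thesis
      unfolding assms(8) floor_divide_of_nat_eq by (simp only: of_nat_add of_nat_mult)
  qed
  \<comment> \<open>Both branches of the formula express \<open>q * k\<close>: the distance from it
    up to \<open>a + K\<close> is the remainder \<open>r\<close>, or a full \<open>k\<close> when
    the remainder vanishes.\<close>
  have qk: "real q * real k = real a + real K - (if r > 0 then real_of_int r else real k)"
  proof (cases "r > 0")
    case True
    then have "(a + K) mod k > 0" by (simp add: r)
    \<comment> \<open>From \<open>a + K - 1\<close> to \<open>a + K\<close> the quotient by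
      \<open>k\<close> grows exactly when \<open>k\<close> divides \<open>a + K\<close>.\<close>
    then have "q = (a + K) div k"
      unfolding q_def using div_Suc[of "a + K - 1" k] assms(1) by (auto split: if_splits)
    then have "q * k + (a + K) mod k = a + K" by simp
    then show ?thesis
      using True by (simp add: r flip: of_nat_mult of_nat_add)
  next
    case False
    then have "(a + K) mod k = 0" by (simp add: r)
    moreover from this have "(a + K) div k = Suc q"
      unfolding q_def using div_Suc[of "a + K - 1" k] assms(1) by (auto split: if_splits)
    ultimately have "Suc q * k = a + K"
      using div_mult_mod_eq[of "a + K" k] by simp
    then have "real (Suc q * k) = real (a + K)" by (simp only:)
    with False show ?thesis by (simp add: algebra_simps)
  qed
  have "real a * (real a + real K - (if r > 0 then real_of_int r else real k)) / real k = real q * real a"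
    unfolding qk[symmetric] using assms(4) by simp
  then have "real N = (if r > 0
      then real a * (real a + real K - real_of_int r) / real k + (real a + real K) * real d
      else real a * (real a + real K - real k) / real k + (real a + real K) * real d)"
    by (simp add: N_def split: if_splits)
  moreover have "r > 0 \<or> r = 0"
    using r by linarith
  moreover have "int N = (int q + 1 - 1) * int a + int (a + K) * int d"
    by (simp add: N_def)
  ultimately show ?thesis
    unfolding frob ceil by blast
qed

end
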